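(* For any integers $n\ge d\ge 3$, $$ \begin{aligned} Q(4n,d)={}&\sum_{k=0}^{\lfloor\frac{d-1}{2}\rfloor} \sum_{j=0}^{2k+1}\frac{2^{k+2}(-1)^{\lfloor\frac{k}{2}\rfloor +j+d}}{(2k+1)!} \binom{2k+1}{j}\binom{\frac{j-2}{4}}{d}\, \zeta(4n-2k)\,\pi^{2k} \\ &+\sum_{k=0}^{\lfloor\frac{d-2}{4}\rfloor}\sum_{j=0}^{4k+2} \frac{2^{2k+5}(-1)^{k+j+d}}{(4k+2)!}\binom{4k+2}{j}\binom{\frac{j-2}{4}}{d} \left(Q(4n-4k,2)-\frac{7}{8}\zeta(4n-4k) \right) \pi^{4k}. \end{aligned} $$
   Context: For positive integers $s_1,\dots,s_d$ with $s_1>1$, the multiple zeta value is $$\zeta(s_1,\dots,s_d)=\sum_{k_1>\dots>k_d>0} k_1^{-s_1}\cdots k_d^{-s_d},$$ the sum running over integers $k_1>\dots>k_d>0$; for $d=1$ this is the Riemann zeta value $\zeta(s)$. For positive integers $n,d$ define the restricted sum $$Q(4n,d)=\sum_{\substack{j_1+\cdots+j_d=n\\ j_1,\dots,j_d>0}}\zeta(4j_1,\dots,4j_d),$$ the sum running over $d$-tuples of positive integers. For a rational number $a$ and an integer $d\ge 0$, $\binom{a}{d}=\frac{a(a-1)\cdots(a-d+1)}{d!}$ is the generalized binomial coefficient. *)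

theory Defs
  imports "HOL-Analysis.Analysis"
begin

text \<open>
  Finite tuples are rendered as lists. The value is meaningful for a nonempty list of
  positive exponents whose head is greater than 1; the series then converges (and, having
  nonnegative terms, it does so unconditionally). \<^const>\<open>infsum\<close> returns 0
  on non-summable families.
\<close>

definition mzv :: "nat list \<Rightarrow> real" where
  "mzv s = (\<Sum>\<^sub>\<infinity>k \<in> {k :: nat list. length k = length s \<and> sorted_wrt (>) k \<and> (\<forall>x\<in>set k. 0 < x)}.
              \<Prod>i<length s. 1 / real (k ! i) ^ (s ! i))"

text \<open>
  The first argument is the weight, so \<open>Q (4 * n) d\<close> is the sum over the
  compositions of \<open>n\<close> into \<open>d\<close> positive parts (a finite set).
\<close>

definition Q :: "nat \<Rightarrow> nat \<Rightarrow> real" where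
  "Q m d = (\<Sum>j \<in> {j :: nat list. length j = d \<and> (\<forall>x\<in>set j. 0 < x) \<and> 4 * sum_list j = m}.
              mzv (map (\<lambda>x. 4 * x) j))"

end

theory Submission
  imports Defs "HOL-Complex_Analysis.Cauchy_Integral_Formula"
begin

text \<open>
  With \<open>P(x) = \<Prod>\<^sub>k (1 - x\<^sup>4 / k\<^sup>4)\<close>, the generating function of the sums \<open>Q(4n, d)\<close>
  satisfies \<open>P(x) \<cdot> \<Sum>\<^sub>n Q(4n, d) x\<^bsup>4n\<^esup> = (-1)\<^bsup>d\<^esup> \<Sum>\<^sub>m (m choose d) p\<^sub>m x\<^bsup>4m\<^esup>\<close>,
  where \<open>P(x) = \<Sum>\<^sub>m p\<^sub>m x\<^bsup>4m\<^esup>\<close>. Multiplying by \<open>\<pi>\<^sup>2 x\<^sup>2\<close> turns \<open>P\<close> into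
  \<open>F(x) = sin (\<pi> x) sinh (\<pi> x)\<close> and the weight of \<open>x\<^bsup>M\<^esup>\<close> into \<open>((M - 2) / 4 choose d)\<close>, a
  polynomial of degree \<open>d\<close> in \<open>M\<close>. Newton's forward difference formula writes the weighted series
  as a combination of the \<open>x\<^bsup>N\<^esup> F\<^bsup>(N)\<^esup>(x)\<close> with \<open>N \<le> d\<close>. Each of them is \<open>F\<close> times an explicit
  series in \<open>u = \<pi> x cot (\<pi> x)\<close> and \<open>v = \<pi> x coth (\<pi> x)\<close>, because \<open>F\<^bsup>(4)\<^esup> = - 4 \<pi>\<^sup>4 F\<close>.
  The coefficients of \<open>u \<plusminus> v\<close> are zeta values, and those of \<open>u v\<close> are eliminated through the
  instance \<open>d = 2\<close>.
\<close>

unbundle no vec_syntax and fps_syntax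

section \<open>Coefficientwise limits of formal power series\<close>

definition fps_lim :: "(nat \<Rightarrow> real fps) \<Rightarrow> real fps \<Rightarrow> bool" where
  "fps_lim f F \<longleftrightarrow> (\<forall>m. (\<lambda>K. f K $ m) \<longlonglongrightarrow> F $ m)"

lemma fps_limD: "fps_lim f F \<Longrightarrow> (\<lambda>K. f K $ m) \<longlonglongrightarrow> F $ m"
  by (simp add: fps_lim_def)

lemma fps_lim_unique: "fps_lim f F \<Longrightarrow> fps_lim f G \<Longrightarrow> F = G"
  unfolding fps_lim_def by (intro fps_ext) (blast intro: LIMSEQ_unique)

lemma fps_lim_const: "fps_lim (\<lambda>_. F) F"
  by (simp add: fps_lim_def)

lemma fps_lim_mult: "fps_lim f F \<Longrightarrow> fps_lim g G \<Longrightarrow> fps_lim (\<lambda>K. f K * g K) (F * G)"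
  unfolding fps_lim_def fps_mult_nth by (intro allI tendsto_intros) auto

lemma fps_lim_deriv: "fps_lim f F \<Longrightarrow> fps_lim (\<lambda>K. fps_deriv (f K)) (fps_deriv F)"
  unfolding fps_lim_def fps_deriv_nth by (intro allI tendsto_intros) auto

lemma fps_lim_cancel_left:
  assumes f: "fps_lim f F" and fg: "fps_lim (\<lambda>K. f K * g K) H"
    and f0: "\<And>K. f K $ 0 = 1"
  obtains G where "fps_lim g G" "F * G = H"
proof -
  have F0: "F $ 0 = 1"
    using fps_limD[OF f, of 0] f0 by (simp add: LIMSEQ_const_iff)
  define G where "G = inverse F * H"
  have FG: "F * G = H"
    using F0 by (simp add: G_def inverse_mult_eq_1' flip: mult.assoc)
  have rec: "v $ m = (u * v) $ m - (\<Sum>i=1..m. u $ i * v $ (m - i))" if "u $ 0 = 1" for u v :: "real fps" and m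
    using that by (simp add: fps_mult_nth sum.atLeast_Suc_atMost)
  have "(\<lambda>K. g K $ m) \<longlonglongrightarrow> G $ m" for m
  proof (induction m rule: less_induct)
    case (less m)
    have "(\<lambda>K. (f K * g K) $ m - (\<Sum>i=1..m. f K $ i * g K $ (m - i)))
        \<longlonglongrightarrow> (F * G) $ m - (\<Sum>i=1..m. F $ i * G $ (m - i))"
      using less.IH fps_limD[OF f] fps_limD[OF fg] unfolding FG
      by (intro tendsto_intros) auto
    moreover have "g K $ m = (f K * g K) $ m - (\<Sum>i=1..m. f K $ i * g K $ (m - i))" for K
      by (rule rec[OF f0])
    moreover have "G $ m = (F * G) $ m - (\<Sum>i=1..m. F $ i * G $ (m - i))"
      by (rule rec[OF F0])
    ultimately show ?case by presburger
  qed
  then show ?thesis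
    using FG by (intro that[of G]) (simp_all add: fps_lim_def)
qed

section \<open>Finite products and their logarithmic derivatives\<close>

definition lin_prod :: "nat \<Rightarrow> (nat \<Rightarrow> real) \<Rightarrow> nat \<Rightarrow> real fps" where
  "lin_prod r a K = (\<Prod>k=1..K. 1 - fps_const (a k) * fps_X ^ r)"

lemma lin_prod_0 [simp]: "lin_prod r a 0 = 1"
  by (simp add: lin_prod_def)

lemma lin_prod_Suc: "lin_prod r a (Suc K) = (1 - fps_const (a (Suc K)) * fps_X ^ r) * lin_prod r a K"
  by (simp add: lin_prod_def mult.commute)

lemma lin_prod_Suc_nth:
  "lin_prod r a (Suc K) $ m = lin_prod r a K $ m - (if m < r then 0 else a (Suc K) * lin_prod r a K $ (m - r))"
  by (simp add: lin_prod_Suc algebra_simps fps_X_power_mult_nth)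

lemma lin_prod_nth_0: "r > 0 \<Longrightarrow> lin_prod r a K $ 0 = 1"
  by (induction K) (simp_all add: lin_prod_Suc_nth)

text \<open>The expansion of \<open>c X\<^sup>r / (1 - c X\<^sup>r)\<close>.\<close>

definition fps_geo :: "nat \<Rightarrow> real \<Rightarrow> real fps" where
  "fps_geo r c = Abs_fps (\<lambda>m. if m > 0 \<and> r dvd m then c ^ (m div r) else 0)"

lemma fps_geo_nth: "fps_geo r c $ m = (if m > 0 \<and> r dvd m then c ^ (m div r) else 0)"
  by (simp add: fps_geo_def)

lemma fps_geo_eq:
  assumes "r > 0"
  shows "(1 - fps_const c * fps_X ^ r) * fps_geo r c = fps_const c * fps_X ^ r"
proof (rule fps_ext)
  fix m
  have "((1 - fps_const c * fps_X ^ r) * fps_geo r c) $ m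
      = fps_geo r c $ m - (if m < r then 0 else c * fps_geo r c $ (m - r))"
    by (simp add: left_diff_distrib mult.assoc fps_X_power_mult_nth)
  also have "\<dots> = (fps_const c * fps_X ^ r) $ m"
  proof (cases "m < r \<or> m = r")
    case True
    then show ?thesis using assms by (auto simp: fps_geo_nth fps_X_power_nth dest: dvd_imp_le)
  next
    case False
    then obtain l where l: "m = r + l" "l > 0" by (metis less_imp_add_positive linorder_neqE_nat)
    then show ?thesis using assms by (auto simp: fps_geo_nth fps_X_power_nth)
  qed
  finally show "((1 - fps_const c * fps_X ^ r) * fps_geo r c) $ m = (fps_const c * fps_X ^ r) $ m" .
qed

text \<open>Newton's power sums, arranged so that \<open>- r\<close> times this series is the
  logarithmic derivative \<open>X P' / P\<close> of \<open>P = lin_prod r a K\<close>.\<close>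

definition power_sums :: "nat \<Rightarrow> (nat \<Rightarrow> real) \<Rightarrow> nat \<Rightarrow> real fps" where
  "power_sums r a K = (\<Sum>k=1..K. fps_geo r (a k))"

lemma power_sums_Suc: "power_sums r a (Suc K) = power_sums r a K + fps_geo r (a (Suc K))"
  by (simp add: power_sums_def)

lemma power_sums_nth:
  "power_sums r a K $ m = (if m > 0 \<and> r dvd m then \<Sum>k=1..K. a k ^ (m div r) else 0)"
  by (simp add: power_sums_def fps_sum_nth fps_geo_nth)

lemma X_deriv_lin_factor:
  "r > 0 \<Longrightarrow> fps_X * fps_deriv (1 - fps_const c * fps_X ^ r :: real fps) = - of_nat r * fps_const c * fps_X ^ r"
  by (rule fps_ext) (simp add: fps_X_power_nth mult.assoc flip: fps_of_nat)

text \<open>The product rule adds one term per factor: \<open>1 - c X^r\<close> contributes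
  \<open>- r c X^r / (1 - c X^r)\<close>, which is \<open>- r\<close> times
  \<open>fps_geo r c\<close>.\<close>

lemma X_deriv_lin_prod:
  assumes "r > 0"
  shows "fps_X * fps_deriv (lin_prod r a K) = - of_nat r * lin_prod r a K * power_sums r a K"
proof (induction K)
  case 0
  show ?case by (simp add: power_sums_def)
next
  case (Suc K)
  let ?l = "1 - fps_const (a (Suc K)) * fps_X ^ r :: real fps"
  have "fps_X * fps_deriv (lin_prod r a (Suc K))
      = ?l * (fps_X * fps_deriv (lin_prod r a K)) + (fps_X * fps_deriv ?l) * lin_prod r a K"
    unfolding lin_prod_Suc fps_deriv_mult by (simp only: algebra_simps)
  also have "fps_X * fps_deriv ?l = - of_nat r * (?l * fps_geo r (a (Suc K)))"
    using X_deriv_lin_factor[OF assms, of "a (Suc K)"] fps_geo_eq[OF assms, of "a (Suc K)"]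
    by (simp add: mult.assoc)
  finally show ?case
    unfolding Suc lin_prod_Suc power_sums_Suc by (simp only: algebra_simps)
qed

section \<open>Multiple zeta values as limits of truncated sums\<close>

definition decr_lists :: "nat \<Rightarrow> nat \<Rightarrow> nat list set" where
  "decr_lists K d = {k. length k = d \<and> sorted_wrt (>) k \<and> (\<forall>x\<in>set k. 0 < x \<and> x \<le> K)}"

lemma finite_decr_lists [simp]: "finite (decr_lists K d)"
  by (rule finite_subset[OF _ finite_lists_length_eq[of "{..K}" d]]) (auto simp: decr_lists_def)

lemma decr_lists_0_right [simp]: "decr_lists K 0 = {[]}"
  by (auto simp: decr_lists_def)

lemma decr_lists_0_left [simp]: "decr_lists 0 (Suc d) = {}"
  by (auto simp: decr_lists_def length_Suc_conv)

lemma decr_lists_Suc: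
  "decr_lists (Suc K) (Suc d) = decr_lists K (Suc d) \<union> (#) (Suc K) ` decr_lists K d"
  (is "?L = ?R")
proof
  show "?L \<subseteq> ?R"
  proof
    fix k assume k: "k \<in> ?L"
    then obtain x l where xl: "k = x # l" "length l = d"
      by (auto simp: decr_lists_def length_Suc_conv)
    show "k \<in> ?R"
    proof (cases "x = Suc K")
      case True
      with k xl show ?thesis by (fastforce simp: decr_lists_def)
    next
      case False
      with k xl show ?thesis by (fastforce simp: decr_lists_def)
    qed
  qed
  show "?R \<subseteq> ?L" by (auto simp: decr_lists_def le_SucI less_Suc_eq_le)
qed

lemma sum_decr_lists_Suc:
  "(\<Sum>k\<in>decr_lists (Suc K) (Suc d). f k)
    = (\<Sum>k\<in>decr_lists K (Suc d). f k) + (\<Sum>k\<in>decr_lists K d. f (Suc K # k) :: 'a :: comm_monoid_add)"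
proof -
  have "decr_lists K (Suc d) \<inter> (#) (Suc K) ` decr_lists K d = {}"
    by (auto simp: decr_lists_def)
  then show ?thesis
    unfolding decr_lists_Suc by (subst sum.union_disjoint) (auto simp: sum.reindex inj_on_def)
qed

text \<open>Finitely many lists have a common bound on their entries, so the truncations eventually
  contain any finite part of the index set. Sums along them therefore compute the unordered sum
  \<open>infsum\<close>.\<close>

lemma filterlim_decr_lists:
  "filterlim (\<lambda>K. decr_lists K d)
     (finite_subsets_at_top {k. length k = d \<and> sorted_wrt (>) k \<and> (\<forall>x\<in>set k. 0 < x)}) sequentially"
  unfolding filterlim_finite_subsets_at_top
proof (intro allI impI, elim conjE)
  fix X :: "nat list set"
  assume X: "finite X" "X \<subseteq> {k. length k = d \<and> sorted_wrt (>) k \<and> (\<forall>x\<in>set k. 0 < x)}"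
  \<comment> \<open>The inserted 0 keeps \<open>Max\<close> meaningful when no entry occurs at
    all.\<close>
  define K0 where "K0 = Max (insert 0 (\<Union>(set ` X)))"
  have "x \<le> K0" if "k \<in> X" "x \<in> set k" for k x
    unfolding K0_def using X(1) that by (intro Max_ge) auto
  then have "X \<subseteq> decr_lists K d" if "K \<ge> K0" for K
    using X(2) that by (force simp: decr_lists_def)
  moreover have "decr_lists K d \<subseteq> {k. length k = d \<and> sorted_wrt (>) k \<and> (\<forall>x\<in>set k. 0 < x)}" for K
    by (auto simp: decr_lists_def)
  ultimately show "\<forall>\<^sub>F K in sequentially. finite (decr_lists K d) \<and> X \<subseteq> decr_lists K d \<and>
      decr_lists K d \<subseteq> {k. length k = d \<and> sorted_wrt (>) k \<and> (\<forall>x\<in>set k. 0 < x)}"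
    unfolding eventually_sequentially by (metis finite_decr_lists)
qed

text \<open>The terms are nonnegative, so a bound on the truncated sums already gives summability.
  The hypothesis is a bound rather than a condition on the exponents because for depth
  \<open>d\<close> the bound will come from a convergent generating function.\<close>

lemma mzv_limit:
  assumes bound: "\<And>K. (\<Sum>k\<in>decr_lists K (length s). \<Prod>i<length s. 1 / real (k ! i) ^ (s ! i)) \<le> B"
  shows "(\<lambda>K. \<Sum>k\<in>decr_lists K (length s). \<Prod>i<length s. 1 / real (k ! i) ^ (s ! i)) \<longlonglongrightarrow> mzv s"
proof -
  define A where "A = {k :: nat list. length k = length s \<and> sorted_wrt (>) k \<and> (\<forall>x\<in>set k. 0 < x)}"
  define f where "f = (\<lambda>k. \<Prod>i<length s. 1 / real (k ! i) ^ (s ! i))"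
  have f_nonneg: "f k \<ge> 0" for k
    by (auto simp: f_def intro!: prod_nonneg)
  have lim: "filterlim (\<lambda>K. decr_lists K (length s)) (finite_subsets_at_top A) sequentially"
    unfolding A_def by (rule filterlim_decr_lists)
  have "f summable_on A"
  proof (rule nonneg_bdd_above_summable_on)
    show "bdd_above (sum f ` {F. F \<subseteq> A \<and> finite F})"
    proof (rule bdd_aboveI2)
      fix F assume "F \<in> {F. F \<subseteq> A \<and> finite F}"
      then have F: "finite F" "F \<subseteq> A" by auto
      have "eventually (\<lambda>K. F \<subseteq> decr_lists K (length s)) sequentially"
        using lim F unfolding filterlim_finite_subsets_at_top by (metis (mono_tags, lifting) eventually_mono)
      then obtain K where "F \<subseteq> decr_lists K (length s)"
        by (auto simp: eventually_sequentially)
      then have "sum f F \<le> sum f (decr_lists K (length s))"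
        by (intro sum_mono2) (auto simp: f_nonneg)
      also have "\<dots> \<le> B"
        using bound by (simp add: f_def)
      finally show "sum f F \<le> B" .
    qed
  qed (rule f_nonneg)
  then have "(f has_sum infsum f A) A" by (rule has_sum_infsum)
  then have "((\<lambda>F. sum f F) \<longlongrightarrow> infsum f A) (finite_subsets_at_top A)"
    by (simp add: has_sum_def)
  from filterlim_compose[OF this lim] show ?thesis
    by (simp add: f_def A_def mzv_def)
qed

lemma sum_decr_lists_1: "(\<Sum>k\<in>decr_lists K (Suc 0). f k) = (\<Sum>k=1..K. f [k] :: 'a :: comm_monoid_add)"
proof (induction K)
  case (Suc K)
  then show ?case by (subst sum_decr_lists_Suc) simp
qed simp

text \<open>Telescoping, by \<open>1 / (K + 1)^2 <= 1 / K - 1 / (K + 1)\<close>.\<close>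

lemma sum_inverse_squares_le: "K \<ge> 1 \<Longrightarrow> (\<Sum>k=1..K. 1 / real k ^ 2) \<le> 2 - 1 / real K"
proof (induction K rule: nat_induct_at_least)
  case (Suc K)
  have "1 / real (Suc K) ^ 2 \<le> 1 / (real K * real (Suc K))"
    using Suc.hyps by (intro divide_left_mono) (auto simp: power2_eq_square intro!: mult_right_mono)
  also have "\<dots> = 1 / real K - 1 / real (Suc K)"
    using Suc.hyps by (simp add: field_simps)
  finally show ?case using Suc.IH by (simp del: of_nat_Suc)
qed simp

lemma sum_inverse_powers_le:
  assumes "m \<ge> 2"
  shows "(\<Sum>k=1..K. 1 / real k ^ m) \<le> 2"
proof (cases "K = 0")
  case False
  have "(\<Sum>k=1..K. 1 / real k ^ m) \<le> (\<Sum>k=1..K. 1 / real k ^ 2)"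
    using assms by (intro sum_mono divide_left_mono power_increasing) auto
  also have "\<dots> \<le> 2"
    using sum_inverse_squares_le[of K] False by (auto intro: order.trans)
  finally show ?thesis .
qed simp

lemma zeta_limit:
  assumes "m \<ge> 2"
  shows "(\<lambda>K. \<Sum>k=1..K. 1 / real k ^ m) \<longlonglongrightarrow> mzv [m]"
  using mzv_limit[of "[m]" 2] sum_inverse_powers_le[OF assms] by (simp add: sum_decr_lists_1)

section \<open>Generating functions over compositions and binomial weights\<close>

definition weighted_comps :: "nat \<Rightarrow> nat \<Rightarrow> nat \<Rightarrow> nat list set" where
  "weighted_comps r m d = {j. length j = d \<and> (\<forall>x\<in>set j. 0 < x) \<and> r * sum_list j = m}"

lemma finite_weighted_comps:
  assumes "r > 0"
  shows "finite (weighted_comps r m d)"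
proof (rule finite_subset[OF _ finite_lists_length_eq[of "{..m}" d]])
  have "x \<le> r * sum_list j" if "x \<in> set j" for x j
  proof -
    have "x \<le> sum_list j" using that by (intro member_le_sum_list) auto
    also have "\<dots> \<le> r * sum_list j" using assms by simp
    finally show ?thesis .
  qed
  then show "weighted_comps r m d \<subseteq> {xs. set xs \<subseteq> {..m} \<and> length xs = d}"
    by (auto simp: weighted_comps_def)
qed simp

lemma sum_weighted_comps_Suc:
  assumes "r > 0"
  shows "(\<Sum>j\<in>weighted_comps r m (Suc d). f j)
    = (\<Sum>i | 0 < i \<and> r * i \<le> m. \<Sum>j\<in>weighted_comps r (m - r * i) d. f (i # j) :: 'a :: comm_monoid_add)"
proof -
  have "i \<le> m" if "r * i \<le> m" for i
  proof -
    have "i \<le> r * i" using assms by simp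
    then show ?thesis using that by (rule order.trans)
  qed
  then have "{i. 0 < i \<and> r * i \<le> m} \<subseteq> {..m}" by auto
  then have fin: "finite {i. 0 < i \<and> r * i \<le> m}"
    by (rule finite_subset) simp
  have "(\<Sum>i | 0 < i \<and> r * i \<le> m. \<Sum>j\<in>weighted_comps r (m - r * i) d. f (i # j))
      = (\<Sum>(i, j)\<in>(SIGMA i:{i. 0 < i \<and> r * i \<le> m}. weighted_comps r (m - r * i) d). f (i # j))"
    using fin finite_weighted_comps[OF assms] by (subst sum.Sigma) auto
  also have "\<dots> = (\<Sum>j\<in>weighted_comps r m (Suc d). f j)"
    by (rule sum.reindex_bij_witness[of _ "\<lambda>j. (hd j, tl j)" "\<lambda>(i, j). i # j"])
       (auto simp: weighted_comps_def length_Suc_conv algebra_simps)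
  finally show ?thesis ..
qed

lemma prod_list_fps_geo_nth:
  assumes "r > 0"
  shows "prod_list (map (\<lambda>x. fps_geo r (a x)) ks) $ m
    = (\<Sum>j\<in>weighted_comps r m (length ks). \<Prod>i<length ks. a (ks ! i) ^ (j ! i))"
proof (induction ks arbitrary: m)
  case Nil
  have "weighted_comps r m 0 = (if m = 0 then {[]} else {})"
    by (auto simp: weighted_comps_def)
  then show ?case by simp
next
  case (Cons x ks)
  let ?I = "{i. 0 < i \<and> r * i \<le> m}" and ?G = "prod_list (map (\<lambda>x. fps_geo r (a x)) ks)"
  have "prod_list (map (\<lambda>x. fps_geo r (a x)) (x # ks)) $ m = (\<Sum>i=0..m. fps_geo r (a x) $ i * ?G $ (m - i))"
    by (simp add: fps_mult_nth)
  also have "\<dots> = (\<Sum>i\<in>(*) r ` ?I. fps_geo r (a x) $ i * ?G $ (m - i))"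
    by (rule sum.mono_neutral_right) (auto simp: fps_geo_nth elim!: dvdE)
  also have "\<dots> = (\<Sum>i\<in>?I. a x ^ i * ?G $ (m - r * i))"
    using assms by (subst sum.reindex) (auto simp: inj_on_def fps_geo_nth)
  also have "\<dots> = (\<Sum>j\<in>weighted_comps r m (length (x # ks)). \<Prod>i<length (x # ks). a ((x # ks) ! i) ^ (j ! i))"
    using sum_weighted_comps_Suc[OF assms, where f="\<lambda>j. \<Prod>i<length (x # ks). a ((x # ks) ! i) ^ (j ! i)"]
    by (simp add: Cons prod.lessThan_Suc_shift sum_distrib_left del: prod.lessThan_Suc)
  finally show ?case .
qed

text \<open>The elementary symmetric polynomial of degree \<open>d\<close> in the series
  \<open>fps_geo r (a 1), ..., fps_geo r (a K)\<close>. For \<open>r = 4\<close> and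
  \<open>a k = 1 / k^4\<close> it is the generating function of \<open>Q(4n, d)\<close> with all
  summation indices cut off at \<open>K\<close>.\<close>

definition comp_gf :: "nat \<Rightarrow> (nat \<Rightarrow> real) \<Rightarrow> nat \<Rightarrow> nat \<Rightarrow> real fps" where
  "comp_gf r a d K = (\<Sum>k\<in>decr_lists K d. prod_list (map (\<lambda>x. fps_geo r (a x)) k))"

lemma comp_gf_0 [simp]: "comp_gf r a 0 K = 1"
  by (simp add: comp_gf_def)

lemma comp_gf_Suc_0 [simp]: "comp_gf r a (Suc d) 0 = 0"
  by (simp add: comp_gf_def)

lemma comp_gf_Suc:
  "comp_gf r a (Suc d) (Suc K) = comp_gf r a (Suc d) K + fps_geo r (a (Suc K)) * comp_gf r a d K"
  unfolding comp_gf_def by (subst sum_decr_lists_Suc) (simp add: sum_distrib_left)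

lemma comp_gf_nth:
  assumes "r > 0"
  shows "comp_gf r a d K $ m
    = (\<Sum>j\<in>weighted_comps r m d. \<Sum>k\<in>decr_lists K d. \<Prod>i<d. a (k ! i) ^ (j ! i))"
proof -
  have "comp_gf r a d K $ m = (\<Sum>k\<in>decr_lists K d. \<Sum>j\<in>weighted_comps r m d. \<Prod>i<d. a (k ! i) ^ (j ! i))"
    unfolding comp_gf_def fps_sum_nth prod_list_fps_geo_nth[OF assms]
    by (intro sum.cong refl) (auto simp: decr_lists_def)
  also have "\<dots> = (\<Sum>j\<in>weighted_comps r m d. \<Sum>k\<in>decr_lists K d. \<Prod>i<d. a (k ! i) ^ (j ! i))"
    by (rule sum.swap)
  finally show ?thesis .
qed

text \<open>The shift \<open>s\<close> makes the weight compatible with multiplication by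
  \<open>X^s\<close>: it is 0 for the product over \<open>k\<close> and 2 once that product has been
  multiplied by \<open>pi^2 X^2\<close>.\<close>

definition gbinomial_weight :: "real \<Rightarrow> real \<Rightarrow> nat \<Rightarrow> real fps \<Rightarrow> real fps" where
  "gbinomial_weight r s d f = Abs_fps (\<lambda>m. (-1) ^ d * (((real m - s) / r) gchoose d) * f $ m)"

lemma gbinomial_weight_nth:
  "gbinomial_weight r s d f $ m = (-1) ^ d * (((real m - s) / r) gchoose d) * f $ m"
  by (simp add: gbinomial_weight_def)

lemma gbinomial_weight_0 [simp]: "gbinomial_weight r s 0 f = f"
  by (rule fps_ext) (simp add: gbinomial_weight_nth)

lemma gbinomial_weight_1: "gbinomial_weight r 0 (Suc d) 1 = 0"
  by (rule fps_ext) (simp add: gbinomial_weight_nth)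

text \<open>Multiplication by \<open>X^r\<close> raises \<open>m / r\<close> by one, so Pascal's
  rule splits the shifted weight. The sign \<open>(-1)^d\<close> in the weight makes the extra term
  appear with a plus.\<close>

lemma gbinomial_weight_lin_factor:
  assumes "r > 0"
  shows "gbinomial_weight (real r) 0 (Suc d) ((1 - fps_const c * fps_X ^ r) * f)
    = (1 - fps_const c * fps_X ^ r) * gbinomial_weight (real r) 0 (Suc d) f
      + fps_const c * fps_X ^ r * gbinomial_weight (real r) 0 d f"
proof (rule fps_ext)
  fix m
  show "gbinomial_weight (real r) 0 (Suc d) ((1 - fps_const c * fps_X ^ r) * f) $ m
    = ((1 - fps_const c * fps_X ^ r) * gbinomial_weight (real r) 0 (Suc d) f
      + fps_const c * fps_X ^ r * gbinomial_weight (real r) 0 d f) $ m"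
  proof (cases "m < r")
    case True
    then show ?thesis
      by (simp add: left_diff_distrib mult.assoc fps_X_power_mult_nth gbinomial_weight_nth)
  next
    case False
    then obtain l where l: "m = r + l" by (metis le_Suc_ex not_less)
    have "(real m / real r) gchoose Suc d = (real l / real r gchoose d) + (real l / real r gchoose Suc d)"
      using gbinomial_Suc_Suc[of "real l / real r" d] assms by (simp add: l add_divide_distrib add.commute)
    then show ?thesis
      by (simp add: l left_diff_distrib mult.assoc fps_X_power_mult_nth gbinomial_weight_nth)
         (simp add: algebra_simps)
  qed
qed

text \<open>
  Finite form of the functional equation for the generating function
  \<open>\<Prod>\<^sub>k (1 + Y c\<^sub>k / (1 - c\<^sub>k)) = \<Prod>\<^sub>k (1 - (1 - Y) c\<^sub>k) / \<Prod>\<^sub>k (1 - c\<^sub>k)\<close>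
  with \<open>c\<^sub>k = a\<^sub>k X\<^sup>r\<close>, read off at \<open>Y\<^sup>d\<close>.
\<close>

lemma lin_prod_mult_comp_gf:
  assumes "r > 0"
  shows "lin_prod r a K * comp_gf r a d K = gbinomial_weight (real r) 0 d (lin_prod r a K)"
proof (induction K arbitrary: d)
  case 0
  show ?case by (cases d) (simp_all add: gbinomial_weight_1)
next
  case (Suc K)
  show ?case
  proof (cases d)
    case (Suc e)
    let ?l = "1 - fps_const (a (Suc K)) * fps_X ^ r :: real fps"
    have "lin_prod r a (Suc K) * comp_gf r a (Suc e) (Suc K)
        = ?l * (lin_prod r a K * comp_gf r a (Suc e) K)
          + (?l * fps_geo r (a (Suc K))) * (lin_prod r a K * comp_gf r a e K)"
      unfolding lin_prod_Suc comp_gf_Suc by (simp only: algebra_simps)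
    then show ?thesis
      unfolding Suc Suc.IH fps_geo_eq[OF assms]
      by (simp add: lin_prod_Suc gbinomial_weight_lin_factor[OF assms])
  qed simp
qed

lemma fps_lim_gbinomial_weight:
  "fps_lim f F \<Longrightarrow> fps_lim (\<lambda>K. gbinomial_weight r s d (f K)) (gbinomial_weight r s d F)"
  unfolding fps_lim_def gbinomial_weight_nth by (intro allI tendsto_intros) auto

text \<open>A convergent coefficient is bounded in \<open>K\<close>, and so is each of its finitely
  many nonnegative summands, one per composition. This is the bound that \<open>mzv_limit\<close>
  requires, so every summand tends to its multiple zeta value.\<close>

lemma fps_lim_comp_gf_Q:
  assumes G: "fps_lim (comp_gf 4 (\<lambda>k. 1 / real k ^ 4) d) G"
  shows "G = Abs_fps (\<lambda>m. Q m d)"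
proof (rule fps_ext)
  fix m
  define S where "S = (\<lambda>j K. \<Sum>k\<in>decr_lists K d. \<Prod>i<d. (1 / real (k ! i) ^ 4) ^ (j ! i))"
  have S_nonneg: "S j K \<ge> 0" for j K
    unfolding S_def by (intro sum_nonneg prod_nonneg) auto
  have lim: "(\<lambda>K. \<Sum>j\<in>weighted_comps 4 m d. S j K) \<longlonglongrightarrow> G $ m"
    using fps_limD[OF G, of m] by (simp add: comp_gf_nth S_def)
  then have "Bseq (\<lambda>K. \<Sum>j\<in>weighted_comps 4 m d. S j K)"
    by (intro convergent_imp_Bseq convergentI)
  then obtain B where B: "\<And>K. (\<Sum>j\<in>weighted_comps 4 m d. S j K) \<le> B"
    by (elim BseqE) (auto dest: abs_le_D1)
  have "(\<lambda>K. S j K) \<longlonglongrightarrow> mzv (map (\<lambda>x. 4 * x) j)" if j: "j \<in> weighted_comps 4 m d" for j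
  proof -
    have S: "S j K = (\<Sum>k\<in>decr_lists K (length (map (\<lambda>x. 4 * x) j)).
        \<Prod>i<length (map (\<lambda>x. 4 * x) j). 1 / real (k ! i) ^ (map (\<lambda>x. 4 * x) j ! i))" for K
      using j by (auto simp: S_def weighted_comps_def power_mult power_one_over power_divide
          intro!: sum.cong prod.cong)
    have "S j K \<le> B" for K
    proof -
      have "S j K \<le> (\<Sum>j\<in>weighted_comps 4 m d. S j K)"
        using j S_nonneg finite_weighted_comps[of 4] by (intro member_le_sum) auto
      then show ?thesis using B by (rule order.trans)
    qed
    then show ?thesis
      using mzv_limit[of "map (\<lambda>x. 4 * x) j" B] unfolding S by blast
  qed
  then have "(\<lambda>K. \<Sum>j\<in>weighted_comps 4 m d. S j K) \<longlonglongrightarrow> Q m d"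
    unfolding Q_def weighted_comps_def by (intro tendsto_sum) auto
  then show "G $ m = Abs_fps (\<lambda>m. Q m d) $ m"
    using lim by (auto intro: LIMSEQ_unique)
qed

section \<open>Euler's sine product and the even zeta values\<close>

definition even_zeta_fps :: "real \<Rightarrow> real fps" where
  "even_zeta_fps e = Abs_fps (\<lambda>m. if m > 0 \<and> even m then e ^ (m div 2) * mzv [m] else 0)"

lemma power_sums_square_nth:
  "power_sums 2 (\<lambda>k. e / real k ^ 2) K $ m
    = (if m > 0 \<and> even m then e ^ (m div 2) * (\<Sum>k=1..K. 1 / real k ^ m) else 0)"
  by (auto simp: power_sums_nth power_divide sum_distrib_left simp flip: power_mult)

lemma fps_lim_power_sums_square:
  "fps_lim (power_sums 2 (\<lambda>k. e / real k ^ 2)) (even_zeta_fps e)"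
  unfolding fps_lim_def
proof
  fix m
  show "(\<lambda>K. power_sums 2 (\<lambda>k. e / real k ^ 2) K $ m) \<longlonglongrightarrow> even_zeta_fps e $ m"
  proof (cases "m > 0 \<and> even m")
    case True
    then have "m \<ge> 2" by (auto elim!: evenE)
    from tendsto_mult_left[OF zeta_limit[OF this], of "e ^ (m div 2)"] True show ?thesis
      by (simp add: power_sums_square_nth even_zeta_fps_def)
  next
    case False
    then show ?thesis by (auto simp: power_sums_square_nth even_zeta_fps_def)
  qed
qed

lemma fps_X_mult_deriv_nth: "(fps_X * fps_deriv f) $ m = real m * f $ m"
  by simp

text \<open>Newton's identities, from comparing coefficients in \<open>X P' = - 2 P S\<close>. Only
  \<open>i < m\<close> survives on the right because \<open>S\<close> has no constant term.\<close>

lemma lin_prod_square_rec: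
  assumes "m > 0"
  shows "lin_prod 2 (\<lambda>k. 1 / real k ^ 2) K $ m
    = - (2 / real m) * (\<Sum>i<m. lin_prod 2 (\<lambda>k. 1 / real k ^ 2) K $ i
          * power_sums 2 (\<lambda>k. 1 / real k ^ 2) K $ (m - i))"
proof -
  let ?p = "lin_prod 2 (\<lambda>k. 1 / real k ^ 2) K" and ?s = "power_sums 2 (\<lambda>k. 1 / real k ^ 2) K"
  have "real m * ?p $ m = (fps_const (- 2) * (?p * ?s)) $ m"
    using X_deriv_lin_prod[of 2 "\<lambda>k. 1 / real k ^ 2" K]
    unfolding fps_X_mult_deriv_nth[symmetric] by (simp add: mult.assoc numeral_fps_const)
  also have "\<dots> = - 2 * (\<Sum>i<m. ?p $ i * ?s $ (m - i))"
    unfolding fps_mult_left_const_nth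
    unfolding fps_mult_nth atLeast0AtMost lessThan_Suc_atMost[symmetric] sum.lessThan_Suc
    by (simp add: power_sums_nth[of _ _ _ 0])
  finally show ?thesis using assms by (simp add: field_simps)
qed

text \<open>A bound uniform in \<open>K\<close>, to serve as the majorant in Tannery's theorem. The
  power sums are at most 2 in absolute value, and base 5 closes the induction: the sum of
  \<open>2 * 5^i\<close> over \<open>i < m\<close> is \<open>(5^m - 1) / 2\<close>, and the
  prefactor \<open>2 / m\<close> is at most 2.\<close>

lemma lin_prod_square_bound: "\<bar>lin_prod 2 (\<lambda>k. 1 / real k ^ 2) K $ m\<bar> \<le> 5 ^ m"
proof (induction m rule: less_induct)
  case (less m)
  let ?p = "lin_prod 2 (\<lambda>k. 1 / real k ^ 2) K" and ?s = "power_sums 2 (\<lambda>k. 1 / real k ^ 2) K"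
  show ?case
  proof (cases "m = 0")
    case True
    then show ?thesis by (simp add: lin_prod_nth_0)
  next
    case False
    have s: "\<bar>?s $ j\<bar> \<le> 2" for j
      using sum_inverse_powers_le[of j K] power_sums_square_nth[of 1 K j]
      by (auto simp: sum_nonneg elim!: evenE)
    have "\<bar>\<Sum>i<m. ?p $ i * ?s $ (m - i)\<bar> \<le> (\<Sum>i<m. \<bar>?p $ i * ?s $ (m - i)\<bar>)"
      by (rule sum_abs)
    also have "\<dots> \<le> (\<Sum>i<m. 5 ^ i * 2)"
      unfolding abs_mult by (intro sum_mono mult_mono less.IH s) auto
    also have "\<dots> = (5 ^ m - 1) / 2"
      by (simp add: geometric_sum flip: sum_distrib_right)
    finally have "2 / real m * \<bar>\<Sum>i<m. ?p $ i * ?s $ (m - i)\<bar> \<le> 2 / 1 * (5 ^ m / 2)"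
      using False by (intro mult_mono frac_le) auto
    then show ?thesis
      using lin_prod_square_rec[of m K] False by (simp add: abs_mult)
  qed
qed

lemma lin_prod_square_convergent: "convergent (\<lambda>K. lin_prod 2 (\<lambda>k. 1 / real k ^ 2) K $ m)"
proof (induction m rule: less_induct)
  case (less m)
  show ?case
  proof (cases "m = 0")
    case True
    then show ?thesis by (simp add: lin_prod_nth_0 convergent_const)
  next
    case False
    then have m: "m > 0" by simp
    have "convergent (\<lambda>K. power_sums 2 (\<lambda>k. 1 / real k ^ 2) K $ j)" for j
      using fps_limD[OF fps_lim_power_sums_square] by (rule convergentI)
    then have "convergent (\<lambda>K. - (2 / real m) * (\<Sum>i<m. lin_prod 2 (\<lambda>k. 1 / real k ^ 2) K $ i
          * power_sums 2 (\<lambda>k. 1 / real k ^ 2) K $ (m - i)))"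
      using less.IH by (intro convergent_mult convergent_const convergent_sum) auto
    then show ?thesis
      by (simp only: lin_prod_square_rec[OF m])
  qed
qed

lemma lin_prod_sums:
  "(\<lambda>m. lin_prod r a K $ m * x ^ m) sums (\<Prod>k=1..K. 1 - a k * x ^ r)"
proof (induction K)
  case 0
  have "(\<lambda>m. lin_prod r a 0 $ m * x ^ m) = (\<lambda>m. if m = 0 then 1 else 0)"
    by (auto simp: fun_eq_iff)
  then show ?case using sums_single[of 0 "\<lambda>_. 1 :: real"] by simp
next
  case (Suc K)
  let ?P = "\<Prod>k=1..K. 1 - a k * x ^ r" and ?p = "lin_prod r a K"
  define g where "g = (\<lambda>m. (if m < r then 0 else a (Suc K) * ?p $ (m - r)) * x ^ m)"
  have "(\<lambda>m. (a (Suc K) * x ^ r) * (?p $ m * x ^ m)) sums ((a (Suc K) * x ^ r) * ?P)"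
    by (intro sums_mult Suc.IH)
  also have "(\<lambda>m. (a (Suc K) * x ^ r) * (?p $ m * x ^ m)) = (\<lambda>m. g (m + r))"
    by (auto simp: g_def power_add fun_eq_iff)
  finally have "g sums ((a (Suc K) * x ^ r) * ?P)"
    by (subst (asm) sums_zero_iff_shift) (auto simp: g_def)
  from sums_diff[OF Suc.IH this] show ?case
    by (simp add: lin_prod_Suc_nth g_def algebra_simps)
qed

lemma fps_sin_nth_eq_sin_coeff: "fps_sin c $ m = sin_coeff m * c ^ m"
  by (simp add: fps_sin_def sin_coeff_def)

text \<open>
  Euler's product converges coefficientwise; Tannery's theorem identifies the limit with the sine
  series near 0.
\<close>

lemma fps_lim_sine_product:
  obtains F where "fps_lim (lin_prod 2 (\<lambda>k. 1 / real k ^ 2)) F"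
    and "fps_const pi * fps_X * F = fps_sin pi"
proof -
  define F where "F = Abs_fps (\<lambda>m. lim (\<lambda>K. lin_prod 2 (\<lambda>k. 1 / real k ^ 2) K $ m))"
  have F: "fps_lim (lin_prod 2 (\<lambda>k. 1 / real k ^ 2)) F"
    using lin_prod_square_convergent by (simp add: fps_lim_def F_def convergent_LIMSEQ_iff)
  let ?T = "fps_const pi * fps_X * F"
  \<comment> \<open>The radius 1/5 is where the majorant \<open>(5 * |x|)^m\<close> is
    summable.\<close>
  have sums_T: "(\<lambda>m. ?T $ m * x ^ m) sums sin (pi * x)" if x: "\<bar>x\<bar> < 1 / 5" for x
  proof -
    let ?a = "\<lambda>m K. lin_prod 2 (\<lambda>k. 1 / real k ^ 2) K $ m * x ^ m"
    have "norm (?a m K) \<le> (5 * \<bar>x\<bar>) ^ m" for m K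
      using mult_right_mono[OF lin_prod_square_bound[of K m], of "\<bar>x\<bar> ^ m"]
      by (simp add: abs_mult power_abs power_mult_distrib)
    moreover have "summable (\<lambda>m. (5 * \<bar>x\<bar>) ^ m)"
      using x by (intro summable_geometric) auto
    moreover have "(\<lambda>K. ?a m K) \<longlonglongrightarrow> F $ m * x ^ m" for m
      by (intro tendsto_intros fps_limD[OF F])
    ultimately have *: "summable (\<lambda>m. norm (F $ m * x ^ m))"
      "(\<lambda>K. \<Sum>m. ?a m K) \<longlonglongrightarrow> (\<Sum>m. F $ m * x ^ m)"
      using tannerys_theorem[of ?a "\<lambda>m. F $ m * x ^ m" sequentially "\<lambda>m. (5 * \<bar>x\<bar>) ^ m"]
      by (simp_all add: split_def)
    have "(\<lambda>K. pi * x * (\<Sum>m. ?a m K)) \<longlonglongrightarrow> pi * x * (\<Sum>m. F $ m * x ^ m)"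
      by (intro tendsto_intros *(2))
    also have "(\<lambda>K. pi * x * (\<Sum>m. ?a m K)) = (\<lambda>K. pi * x * (\<Prod>k=1..K. 1 - x ^ 2 / real k ^ 2))"
      using sums_unique[OF lin_prod_sums[of 2 "\<lambda>k. 1 / real k ^ 2" _ x]] by simp
    finally have "pi * x * (\<Sum>m. F $ m * x ^ m) = sin (pi * x)"
      using sin_product_formula_real[of x] by (intro LIMSEQ_unique)
    moreover have "(\<lambda>m. pi * x * (F $ m * x ^ m)) sums (pi * x * (\<Sum>m. F $ m * x ^ m))"
      using summable_norm_cancel[OF *(1)] by (intro sums_mult summable_sums)
    moreover have "?T $ Suc m = pi * F $ m" for m
      by (simp add: mult.assoc)
    ultimately have "(\<lambda>m. ?T $ Suc m * x ^ Suc m) sums sin (pi * x)"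
      by (simp only: power_Suc mult_ac)
    then show ?thesis
      by (subst (asm) sums_Suc_iff) (simp add: mult.assoc)
  qed
  define b where "b = (\<lambda>m. ?T $ m - fps_sin pi $ m)"
  have b0: "b 0 = 0"
    by (simp add: b_def fps_sin_nth_eq_sin_coeff mult.assoc)
  have "b m = 0" for m
  proof (rule ccontr)
    assume bm: "b m \<noteq> 0"
    have sums_b: "(\<lambda>m. b m * (x - 0) ^ m) sums 0" if "norm (x - 0) < 1 / 5" for x
      using sums_diff[OF sums_T[of x] sin_converges[of "pi * x"]] that
      by (simp add: b_def fps_sin_nth_eq_sin_coeff left_diff_distrib power_mult_distrib mult.assoc)
    \<comment> \<open>Zeros of a nontrivial power series are isolated, whereas the series with
      coefficients \<open>b\<close> sums to 0 on a whole interval. The isolation result needs an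
      index \<open>m > 0\<close>, which \<open>b0\<close> provides.\<close>
    show False
    proof (rule powser_0_nonzero[of "1 / 5" 0 b "\<lambda>_. 0" m])
      show "m > 0" using bm b0 by (cases m) auto
      fix s :: real
      assume "0 < s" "\<And>z :: real. z \<in> cball 0 s - {0} \<Longrightarrow> (0 :: real) \<noteq> 0"
      from this(1) this(2)[of s] show False by simp
    qed (use bm sums_b in simp_all)
  qed
  then have "?T = fps_sin pi"
    by (intro fps_ext) (simp add: b_def)
  with F that show ?thesis by blast
qed

text \<open>Replaces \<open>X^2\<close> by \<open>e X^2\<close>. For \<open>e = - 1\<close> this
  does the work of the substitution of \<open>i x\<close> for \<open>x\<close> without leaving the
  reals.\<close>

lemma lin_prod_square_twist:
  "lin_prod 2 (\<lambda>k. e / real k ^ 2) K $ m = e ^ (m div 2) * lin_prod 2 (\<lambda>k. 1 / real k ^ 2) K $ m"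
proof (induction K arbitrary: m)
  case 0
  show ?case by (cases m) auto
next
  case (Suc K)
  show ?case
  proof (cases "m < 2")
    case True
    then show ?thesis by (simp add: lin_prod_Suc_nth Suc)
  next
    case False
    then obtain l where "m = 2 + l" by (metis le_Suc_ex not_less)
    then show ?thesis by (simp add: lin_prod_Suc_nth Suc algebra_simps)
  qed
qed

text \<open>The series of \<open>sin (\<pi> x)\<close> for \<open>e = 1\<close> and of \<open>sinh (\<pi> x)\<close> for \<open>e = - 1\<close>.\<close>

definition sine_fps :: "real \<Rightarrow> real fps" where
  "sine_fps e = Abs_fps (\<lambda>m. if even m then 0 else (- e) ^ (m div 2) * pi ^ m / fact m)"

lemma fps_lim_lin_prod_square:
  obtains F where "fps_lim (lin_prod 2 (\<lambda>k. e / real k ^ 2)) F"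
    and "fps_const pi * fps_X * F = sine_fps e"
proof -
  obtain F where F: "fps_lim (lin_prod 2 (\<lambda>k. 1 / real k ^ 2)) F" "fps_const pi * fps_X * F = fps_sin pi"
    using fps_lim_sine_product by blast
  define G where "G = Abs_fps (\<lambda>m. e ^ (m div 2) * F $ m)"
  have "fps_lim (lin_prod 2 (\<lambda>k. e / real k ^ 2)) G"
    unfolding fps_lim_def lin_prod_square_twist[of e] G_def
    using fps_limD[OF F(1)] by (auto intro!: tendsto_intros)
  moreover have "fps_const pi * fps_X * G = sine_fps e"
  proof (rule fps_ext)
    fix m
    have "(fps_const pi * fps_X * F) $ m = fps_sin pi $ m" using F(2) by simp
    then have *: "pi * (if m = 0 then 0 else F $ (m - 1)) = fps_sin pi $ m"
      by (simp add: mult.assoc)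
    show "(fps_const pi * fps_X * G) $ m = sine_fps e $ m"
    proof (cases m)
      case (Suc l)
      have "(fps_const pi * fps_X * G) $ m = e ^ (l div 2) * fps_sin pi $ m"
        using * Suc by (simp add: G_def mult.assoc)
      also have "\<dots> = sine_fps e $ m"
        using Suc power_mult_distrib[of "- 1" e "l div 2"]
        by (auto simp: fps_sin_def sine_fps_def mult_ac simp del: fact_Suc elim!: evenE oddE)
      finally show ?thesis .
    qed (simp add: mult.assoc sine_fps_def)
  qed
  ultimately show ?thesis using that by blast
qed

lemma sine_fps_deriv2: "fps_deriv (fps_deriv (sine_fps e)) = - fps_const (e * pi ^ 2) * sine_fps e"
proof (rule fps_ext)
  fix m
  have "real (m + 1) * (real (m + 2) * (x / fact (m + 2))) = x / fact m" for x
  proof -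
    have "fact (m + 2) = real (m + 1) * (real (m + 2) * fact m)" by simp
    then show ?thesis by (simp del: of_nat_add fact_Suc add_2_eq_Suc')
  qed
  from this[of "(- e) ^ ((m + 2) div 2) * pi ^ (m + 2)"]
  show "fps_deriv (fps_deriv (sine_fps e)) $ m = (- fps_const (e * pi ^ 2) * sine_fps e) $ m"
    by (simp add: sine_fps_def mult.assoc power2_eq_square del: fact_Suc)
qed

text \<open>The limit of the logarithmic derivatives of the finite products, with the prefactor
  \<open>pi X\<close> contributing the 1. So \<open>1 - 2 * even_zeta_fps e\<close> is the series of
  \<open>pi x cot (pi x)\<close> for \<open>e = 1\<close> and of \<open>pi x coth (pi x)\<close> for
  \<open>e = - 1\<close>.\<close>

lemma X_deriv_sine_fps: "fps_X * fps_deriv (sine_fps e) = sine_fps e * (1 - 2 * even_zeta_fps e)"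
proof -
  obtain F where F: "fps_lim (lin_prod 2 (\<lambda>k. e / real k ^ 2)) F" "fps_const pi * fps_X * F = sine_fps e"
    using fps_lim_lin_prod_square by blast
  have "fps_lim (\<lambda>K. fps_X * fps_deriv (lin_prod 2 (\<lambda>k. e / real k ^ 2) K)) (fps_X * fps_deriv F)"
    by (intro fps_lim_mult fps_lim_deriv fps_lim_const F)
  moreover have "fps_lim (\<lambda>K. - of_nat 2 * lin_prod 2 (\<lambda>k. e / real k ^ 2) K
      * power_sums 2 (\<lambda>k. e / real k ^ 2) K) (- of_nat 2 * F * even_zeta_fps e)"
    by (intro fps_lim_mult fps_lim_power_sums_square fps_lim_const F)
  ultimately have "fps_X * fps_deriv F = - of_nat 2 * F * even_zeta_fps e"
    by (simp add: X_deriv_lin_prod fps_lim_unique)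
  then have XF: "fps_X * fps_deriv F = - (2 * (F * even_zeta_fps e))"
    by (simp add: mult.assoc)
  have "fps_X * fps_deriv (sine_fps e)
      = fps_const pi * fps_X * F + fps_const pi * fps_X * (fps_X * fps_deriv F)"
    unfolding F(2)[symmetric] by (simp add: algebra_simps)
  also have "\<dots> = (fps_const pi * fps_X * F) * (1 - 2 * even_zeta_fps e)"
    unfolding XF by (simp add: algebra_simps)
  finally show ?thesis by (simp only: F(2))
qed

section \<open>Newton's forward difference formula\<close>

definition fdiff :: "(nat \<Rightarrow> real) \<Rightarrow> nat \<Rightarrow> real" where
  "fdiff f N = (\<Sum>j\<le>N. (-1) ^ (N + j) * real (N choose j) * f j)"

text \<open>Here \<open>fdiff f N\<close> is the \<open>N\<close>-th forward difference of
  \<open>f\<close> at 0; \<open>N + j\<close> has the parity of \<open>N - j\<close>. Rewriting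
  \<open>(N choose j) (j choose i)\<close> as \<open>(N choose i) (N - i choose j - i)\<close>
  leaves an alternating binomial row sum, which vanishes unless \<open>i = N\<close>.\<close>

lemma fdiff_choose: "fdiff (\<lambda>j. real (j choose i)) N = (if i = N then 1 else 0)"
proof (cases "i \<le> N")
  case False
  then show ?thesis by (auto simp: fdiff_def intro!: sum.neutral)
next
  case True
  have "fdiff (\<lambda>j. real (j choose i)) N
      = (\<Sum>j\<in>{i..N}. (-1) ^ (N + j) * real (N choose j) * real (j choose i))"
    unfolding fdiff_def by (rule sum.mono_neutral_right) auto
  also have "\<dots> = (\<Sum>l\<le>N - i. (-1) ^ (N + i + l) * (real (N choose i) * real ((N - i) choose l)))"
  proof (rule sum.reindex_bij_witness[of _ "\<lambda>l. i + l" "\<lambda>j. j - i"])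
    fix j assume j: "j \<in> {i..N}"
    have "real (N choose j) * real (j choose i) = real (N choose i) * real ((N - i) choose (j - i))"
      using choose_mult[of i j N] j by (simp flip: of_nat_mult)
    then show "(-1) ^ (N + i + (j - i)) * (real (N choose i) * real ((N - i) choose (j - i)))
        = (-1) ^ (N + j) * real (N choose j) * real (j choose i)"
      using j by (simp add: mult.assoc)
  qed (use True in auto)
  also have "\<dots> = (-1) ^ (N + i) * real (N choose i) * (\<Sum>l\<le>N - i. (-1) ^ l * real ((N - i) choose l))"
    by (simp add: sum_distrib_left power_add mult_ac)
  also have "\<dots> = (if i = N then 1 else 0)"
    using choose_alternating_sum[of "N - i", where 'a=real] True by auto
  finally show ?thesis .
qed

text \<open>By \<open>fdiff_choose\<close> the differences at 0 are the functionals dual to the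
  basis \<open>M choose N\<close>.\<close>

lemma newton_coeff_eq_fdiff:
  assumes "\<And>M. q M = (\<Sum>N\<le>d. c N * real (M choose N))" and "N \<le> d"
  shows "c N = fdiff q N"
proof -
  have "fdiff q N = (\<Sum>j\<le>N. \<Sum>i\<le>d. c i * ((-1) ^ (N + j) * real (N choose j) * real (j choose i)))"
    unfolding fdiff_def assms(1) by (simp add: sum_distrib_left mult_ac)
  also have "\<dots> = (\<Sum>i\<le>d. c i * fdiff (\<lambda>j. real (j choose i)) N)"
    unfolding fdiff_def by (subst sum.swap) (simp add: sum_distrib_left)
  also have "\<dots> = c N"
    using assms(2) by (simp add: fdiff_choose mult_delta_right)
  finally show ?thesis ..
qed

lemma times_binomial: "real M * real (M choose N) = real (Suc N) * real (M choose Suc N) + real N * real (M choose N)"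
  using gbinomial_mult_1[of "real M" N] by (simp add: binomial_gbinomial)

lemma gbinomial_newton_exists:
  "\<exists>c. \<forall>M. ((real M - s) / r gchoose d) = (\<Sum>N\<le>d. c N * real (M choose N))"
proof (induction d)
  case 0
  show ?case by (rule exI[of _ "\<lambda>_. 1"]) simp
next
  case (Suc d)
  then obtain c where c: "\<And>M. ((real M - s) / r gchoose d) = (\<Sum>N\<le>d. c N * real (M choose N))"
    by blast
  \<comment> \<open>From \<open>(d + 1) (x choose d + 1) = (x - d) (x choose d)\<close> with
    \<open>x = (M - s) / r\<close>: \<open>times_binomial\<close> turns the factor \<open>M\<close>
    into a move from \<open>N\<close> to \<open>N + 1\<close>, the first summand, and a multiple of
    the same basis element, part of the second.\<close>
  define c' where "c' = (\<lambda>N. ((case N of 0 \<Rightarrow> 0 | Suc K \<Rightarrow> c K * real N / r)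
      + (if N \<le> d then c N * ((real N - s) / r - real d) else 0)) / real (Suc d))"
  have "((real M - s) / r gchoose Suc d) = (\<Sum>N\<le>Suc d. c' N * real (M choose N))" for M
  proof -
    have "real (Suc d) * ((real M - s) / r gchoose Suc d)
        = ((real M - s) / r - real d) * ((real M - s) / r gchoose d)"
      using gbinomial_mult_1[of "(real M - s) / r" d] by (simp add: left_diff_distrib)
    also have "\<dots> = (\<Sum>N\<le>d. c N / r * (real M * real (M choose N))
        - c N * (s / r + real d) * real (M choose N))"
      unfolding c sum_distrib_left by (intro sum.cong refl) (simp add: algebra_simps diff_divide_distrib)
    also have "\<dots> = (\<Sum>N\<le>d. c N * real (Suc N) / r * real (M choose Suc N)
        + c N * ((real N - s) / r - real d) * real (M choose N))"
      unfolding times_binomial by (intro sum.cong refl) (simp add: algebra_simps diff_divide_distrib add_divide_distrib)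
    also have "\<dots> = (\<Sum>N\<le>d. c N * real (Suc N) / r * real (M choose Suc N))
        + (\<Sum>N\<le>Suc d. (if N \<le> d then c N * ((real N - s) / r - real d) else 0) * real (M choose N))"
      by (simp add: sum.distrib)
    also have "(\<Sum>N\<le>d. c N * real (Suc N) / r * real (M choose Suc N))
        = (\<Sum>N\<le>Suc d. (case N of 0 \<Rightarrow> 0 | Suc K \<Rightarrow> c K * real N / r) * real (M choose N))"
      by (simp add: sum.atMost_Suc_shift del: sum.atMost_Suc)
    also have "\<dots> + (\<Sum>N\<le>Suc d. (if N \<le> d then c N * ((real N - s) / r - real d) else 0) * real (M choose N))
        = real (Suc d) * (\<Sum>N\<le>Suc d. c' N * real (M choose N))"
      unfolding c'_def sum_distrib_left sum.distrib[symmetric]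
      by (intro sum.cong refl) (simp add: field_simps del: of_nat_Suc)
    finally show ?thesis by (simp del: of_nat_Suc sum.atMost_Suc)
  qed
  then show ?case by blast
qed

lemma gbinomial_newton:
  "((real M - s) / r gchoose d)
    = (\<Sum>N\<le>d. fdiff (\<lambda>j. (real j - s) / r gchoose d) N * real (M choose N))"
proof -
  obtain c where c: "\<And>M. ((real M - s) / r gchoose d) = (\<Sum>N\<le>d. c N * real (M choose N))"
    using gbinomial_newton_exists by blast
  show ?thesis
    unfolding c[of M] using newton_coeff_eq_fdiff[OF c] by (intro sum.cong refl) auto
qed

section \<open>Binomial weights as differential operators\<close>

lemma fps_higher_deriv_nth: "(fps_deriv ^^ N) f $ l = fact N * real (N + l choose N) * f $ (N + l)"
proof (induction N arbitrary: f)
  case (Suc N)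
  have "real (Suc N) * real (Suc (N + l) choose Suc N) = real (Suc (N + l)) * real (N + l choose N)"
    using Suc_times_binomial[of N "N + l"] by (simp only: flip: of_nat_mult)
  with Suc[of "fps_deriv f"] show ?case
    by (simp add: funpow_Suc_right del: funpow.simps of_nat_Suc binomial_Suc_Suc)
qed simp

lemma X_power_mult_higher_deriv_nth:
  "(fps_X ^ N * (fps_deriv ^^ N) f) $ M = fact N * real (M choose N) * f $ M"
proof (cases "M < N")
  case False
  then obtain l where "M = N + l" by (metis le_Suc_ex not_less)
  then show ?thesis by (simp add: fps_X_power_mult_nth fps_higher_deriv_nth)
qed (simp add: fps_X_power_mult_nth)

text \<open>The operator \<open>X^N D^N / N!\<close> multiplies coefficient \<open>M\<close> by
  \<open>M choose N\<close>, so Newton's formula for the weight becomes a differential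
  operator.\<close>

lemma gbinomial_weight_eq_sum_deriv:
  "gbinomial_weight r s d f
    = (\<Sum>N\<le>d. fps_const ((-1) ^ d * fdiff (\<lambda>j. (real j - s) / r gchoose d) N / fact N)
        * (fps_X ^ N * (fps_deriv ^^ N) f))"
proof (rule fps_ext)
  fix M
  have "gbinomial_weight r s d f $ M
      = (-1) ^ d * (\<Sum>N\<le>d. fdiff (\<lambda>j. (real j - s) / r gchoose d) N * real (M choose N)) * f $ M"
    unfolding gbinomial_weight_nth by (subst gbinomial_newton) (rule refl)
  then show "gbinomial_weight r s d f $ M
      = (\<Sum>N\<le>d. fps_const ((-1) ^ d * fdiff (\<lambda>j. (real j - s) / r gchoose d) N / fact N)
        * (fps_X ^ N * (fps_deriv ^^ N) f)) $ M"
    by (simp add: fps_sum_nth X_power_mult_higher_deriv_nth sum_distrib_left sum_distrib_right)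
       (simp add: mult_ac)
qed

lemma gbinomial_weight_X_square:
  "gbinomial_weight r 2 d (fps_const c * fps_X ^ 2 * f) = fps_const c * fps_X ^ 2 * gbinomial_weight r 0 d f"
  by (rule fps_ext) (simp add: mult.assoc fps_X_power_mult_nth gbinomial_weight_nth of_nat_diff)

section \<open>Higher derivatives of sin times sinh\<close>

definition sin_sinh_fps :: "real fps" where
  "sin_sinh_fps = sine_fps 1 * sine_fps (- 1)"

text \<open>\<open>x\<^bsup>N\<^esup> F\<^bsup>(N)\<^esup>(x) / F(x)\<close> for \<open>F(x) = sin (\<pi> x) sinh (\<pi> x)\<close>.\<close>

definition sin_sinh_quotient :: "nat \<Rightarrow> real fps" where
  "sin_sinh_quotient N =
    (let u = 1 - 2 * even_zeta_fps 1; v = 1 - 2 * even_zeta_fps (- 1)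
     in fps_const ((- 4 * pi ^ 4) ^ (N div 4)) * fps_X ^ (4 * (N div 4))
        * [1, u + v, 2 * u * v, 2 * fps_const (pi ^ 2) * fps_X ^ 2 * (u - v)] ! (N mod 4))"

text \<open>Because \<open>s'' = - pi^2 s\<close> and \<open>h'' = pi^2 h\<close>, the terms
  \<open>s'' h\<close> and \<open>s h''\<close> cancel in the second derivative and reinforce each
  other in the fourth, which is again a multiple of \<open>s h\<close>.\<close>

lemma sin_sinh_fps_deriv:
  defines "s \<equiv> sine_fps 1" and "h \<equiv> sine_fps (- 1)"
  shows "fps_deriv sin_sinh_fps = fps_deriv s * h + s * fps_deriv h"
    and "(fps_deriv ^^ 2) sin_sinh_fps = 2 * fps_deriv s * fps_deriv h"
    and "(fps_deriv ^^ 3) sin_sinh_fps = 2 * fps_const (pi ^ 2) * (fps_deriv s * h - s * fps_deriv h)"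
    and "(fps_deriv ^^ 4) sin_sinh_fps = fps_const (- 4 * pi ^ 4) * sin_sinh_fps"
proof -
  define p where "p = fps_const (pi ^ 2)"
  have p: "fps_deriv p = 0" by (simp add: p_def)
  have s: "fps_deriv (fps_deriv s) = - p * s" and h: "fps_deriv (fps_deriv h) = p * h"
    by (simp_all add: s_def h_def p_def sine_fps_deriv2)
  show 1: "fps_deriv sin_sinh_fps = fps_deriv s * h + s * fps_deriv h"
    by (simp add: sin_sinh_fps_def s_def h_def add.commute)
  show 2: "(fps_deriv ^^ 2) sin_sinh_fps = 2 * fps_deriv s * fps_deriv h"
    by (simp add: numeral_2_eq_2 1 s h algebra_simps)
  have "(fps_deriv ^^ 3) sin_sinh_fps = fps_deriv ((fps_deriv ^^ 2) sin_sinh_fps)"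
    by (simp add: eval_nat_numeral)
  then show 3: "(fps_deriv ^^ 3) sin_sinh_fps = 2 * p * (fps_deriv s * h - s * fps_deriv h)"
    by (simp add: 2 s h algebra_simps)
  have "(fps_deriv ^^ 4) sin_sinh_fps = fps_deriv ((fps_deriv ^^ 3) sin_sinh_fps)"
    by (simp add: eval_nat_numeral)
  also have "\<dots> = - 4 * p * p * sin_sinh_fps"
    unfolding 3 by (simp add: s h p sin_sinh_fps_def[folded s_def h_def] algebra_simps)
  also have "- 4 * p * p = fps_const (- 4 * pi ^ 4)"
    by (simp add: p_def numeral_fps_const flip: power_add)
  finally show "(fps_deriv ^^ 4) sin_sinh_fps = fps_const (- 4 * pi ^ 4) * sin_sinh_fps" .
qed

lemma higher_deriv_const_mult:
  "(fps_deriv ^^ N) (fps_const c * f) = fps_const c * (fps_deriv ^^ N) f"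
  by (induction N) simp_all

lemma sin_sinh_fps_deriv_4_mult:
  "(fps_deriv ^^ (4 * q)) sin_sinh_fps = fps_const ((- 4 * pi ^ 4) ^ q) * sin_sinh_fps"
proof (induction q)
  case (Suc q)
  have "(fps_deriv ^^ (4 * Suc q)) sin_sinh_fps = (fps_deriv ^^ 4) ((fps_deriv ^^ (4 * q)) sin_sinh_fps)"
    by (simp add: funpow_add)
  also have "\<dots> = fps_const ((- 4 * pi ^ 4) ^ q) * fps_const (- 4 * pi ^ 4) * sin_sinh_fps"
    by (simp only: Suc higher_deriv_const_mult sin_sinh_fps_deriv(4) mult.assoc)
  also have "\<dots> = fps_const ((- 4 * pi ^ 4) ^ Suc q) * sin_sinh_fps"
    by (simp only: fps_const_mult power_Suc2)
  finally show ?case .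
qed simp

text \<open>With \<open>N = 4 q + r\<close>, each block of four derivatives gives a constant. In the
  remaining \<open>r\<close> derivatives every \<open>s'\<close> or \<open>h'\<close> absorbs one
  \<open>X\<close>, by \<open>X s' = s u\<close> and \<open>X h' = h v\<close>; for
  \<open>r = 3\<close> a factor \<open>X^2\<close> is left over.\<close>

lemma X_power_mult_sin_sinh_deriv:
  "fps_X ^ N * (fps_deriv ^^ N) sin_sinh_fps = sin_sinh_fps * sin_sinh_quotient N"
proof -
  define s h where "s = sine_fps 1" and "h = sine_fps (- 1)"
  define u v where "u = 1 - 2 * even_zeta_fps 1" and "v = 1 - 2 * even_zeta_fps (- 1)"
  define p where "p = fps_const (pi ^ 2)"
  have u: "fps_X * fps_deriv s = s * u" and v: "fps_X * fps_deriv h = h * v"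
    by (simp_all add: s_def h_def u_def v_def X_deriv_sine_fps)
  define q r where "q = N div 4" and "r = N mod 4"
  have N: "N = 4 * q + r" by (simp add: q_def r_def)
  have T: "sin_sinh_fps = s * h" by (simp add: sin_sinh_fps_def s_def h_def)
  have quot: "sin_sinh_quotient N = fps_const ((- 4 * pi ^ 4) ^ q) * fps_X ^ (4 * q)
      * [1, u + v, 2 * u * v, 2 * p * fps_X ^ 2 * (u - v)] ! r"
    by (simp only: sin_sinh_quotient_def Let_def u_def v_def p_def q_def r_def)
  have base: "fps_X ^ r * (fps_deriv ^^ r) sin_sinh_fps
      = sin_sinh_fps * ([1, u + v, 2 * u * v, 2 * p * fps_X ^ 2 * (u - v)] ! r)"
  proof -
    have "r < 4" by (simp add: r_def)
    then consider "r = 0" | "r = 1" | "r = 2" | "r = 3" by linarith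
    then show ?thesis
    proof cases
      case 2
      have "fps_X * (fps_deriv s * h + s * fps_deriv h)
          = (fps_X * fps_deriv s) * h + s * (fps_X * fps_deriv h)" by (simp add: algebra_simps)
      with 2 show ?thesis
        by (simp only: T u v sin_sinh_fps_deriv(1)[folded s_def h_def T])
           (simp add: T sin_sinh_fps_deriv(1)[folded s_def h_def, unfolded T] u v algebra_simps)
    next
      case 3
      have "fps_X ^ 2 * (2 * fps_deriv s * fps_deriv h)
          = 2 * (fps_X * fps_deriv s) * (fps_X * fps_deriv h)" by (simp add: algebra_simps power2_eq_square)
      with 3 show ?thesis
        by (simp only: sin_sinh_fps_deriv(2)[folded s_def h_def] u v) (simp add: T algebra_simps)
    next
      case 4
      have "fps_X ^ 3 * (2 * p * (fps_deriv s * h - s * fps_deriv h))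
          = 2 * p * fps_X ^ 2 * ((fps_X * fps_deriv s) * h - s * (fps_X * fps_deriv h))"
        by (simp add: algebra_simps eval_nat_numeral)
      with 4 show ?thesis
        by (simp only: sin_sinh_fps_deriv(3)[folded s_def h_def p_def] u v)
           (simp add: T algebra_simps eval_nat_numeral)
    qed simp
  qed
  have "fps_X ^ N * (fps_deriv ^^ N) sin_sinh_fps
      = fps_X ^ (4 * q) * fps_X ^ r * (fps_deriv ^^ r) ((fps_deriv ^^ (4 * q)) sin_sinh_fps)"
    unfolding N by (simp add: funpow_add power_add add.commute mult_ac)
  also have "\<dots> = fps_const ((- 4 * pi ^ 4) ^ q) * fps_X ^ (4 * q) * (fps_X ^ r * (fps_deriv ^^ r) sin_sinh_fps)"
    by (simp only: sin_sinh_fps_deriv_4_mult higher_deriv_const_mult mult.assoc mult.left_commute)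
  also have "\<dots> = sin_sinh_fps * sin_sinh_quotient N"
    unfolding base quot by (simp only: mult.assoc mult.left_commute)
  finally show ?thesis .
qed

section \<open>The restricted sums as coefficients of the quotients\<close>

lemma lin_prod_fourth:
  "lin_prod 4 (\<lambda>k. 1 / real k ^ 4) K = lin_prod 2 (\<lambda>k. 1 / real k ^ 2) K * lin_prod 2 (\<lambda>k. - 1 / real k ^ 2) K"
  unfolding lin_prod_def prod.distrib[symmetric]
proof (intro prod.cong refl)
  fix k
  have "fps_const (1 / real k ^ 2) * fps_const (1 / real k ^ 2) = fps_const (1 / real k ^ 4)"
    by (simp flip: power_add)
  then show "1 - fps_const (1 / real k ^ 4) * fps_X ^ 4
      = (1 - fps_const (1 / real k ^ 2) * fps_X ^ 2) * (1 - fps_const (- 1 / real k ^ 2) * fps_X ^ 2)"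
    by (simp add: algebra_simps flip: power_add fps_const_neg)
qed

text \<open>The limit of \<open>lin_prod_mult_comp_gf\<close>, multiplied by
  \<open>pi^2 X^2\<close>, says that \<open>sin_sinh_fps\<close> times the generating function
  \<open>H\<close> of the sums \<open>Q\<close> is the weighted \<open>sin_sinh_fps\<close>. The
  latter is \<open>sin_sinh_fps\<close> times an explicit series, and the common factor is
  cancelled.\<close>

lemma Q_eq_sum_sin_sinh_quotient:
  "Q m d = (\<Sum>N\<le>d. (-1) ^ d * fdiff (\<lambda>j. (real j - 2) / 4 gchoose d) N / fact N * sin_sinh_quotient N $ m)"
proof -
  obtain F where F: "fps_lim (lin_prod 2 (\<lambda>k. 1 / real k ^ 2)) F" "fps_const pi * fps_X * F = sine_fps 1"
    using fps_lim_lin_prod_square[of 1] by blast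
  obtain G where G: "fps_lim (lin_prod 2 (\<lambda>k. - 1 / real k ^ 2)) G" "fps_const pi * fps_X * G = sine_fps (- 1)"
    using fps_lim_lin_prod_square[of "- 1"] by blast
  have FG: "fps_lim (lin_prod 4 (\<lambda>k. 1 / real k ^ 4)) (F * G)"
    using fps_lim_mult[OF F(1) G(1)] unfolding lin_prod_fourth[symmetric] .
  have *: "fps_lim (\<lambda>K. lin_prod 4 (\<lambda>k. 1 / real k ^ 4) K * comp_gf 4 (\<lambda>k. 1 / real k ^ 4) d K)
      (gbinomial_weight 4 0 d (F * G))"
    using fps_lim_gbinomial_weight[OF FG, of 4 0 d] by (simp add: lin_prod_mult_comp_gf)
  obtain H where H: "fps_lim (comp_gf 4 (\<lambda>k. 1 / real k ^ 4) d) H"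
      "F * G * H = gbinomial_weight 4 0 d (F * G)"
    by (rule fps_lim_cancel_left[OF FG *]) (auto simp: lin_prod_nth_0)
  have T: "sin_sinh_fps = fps_const (pi ^ 2) * fps_X ^ 2 * (F * G)"
    unfolding sin_sinh_fps_def F(2)[symmetric] G(2)[symmetric]
    by (simp add: power2_eq_square mult_ac flip: fps_const_mult)
  have "sin_sinh_fps * H = gbinomial_weight 4 2 d sin_sinh_fps"
    unfolding T gbinomial_weight_X_square H(2)[symmetric] by (simp only: mult.assoc)
  also have "\<dots> = sin_sinh_fps * (\<Sum>N\<le>d. fps_const ((-1) ^ d * fdiff (\<lambda>j. (real j - 2) / 4 gchoose d) N / fact N)
      * sin_sinh_quotient N)"
    unfolding gbinomial_weight_eq_sum_deriv X_power_mult_sin_sinh_deriv sum_distrib_left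
    by (simp only: mult_ac)
  finally have "H = (\<Sum>N\<le>d. fps_const ((-1) ^ d * fdiff (\<lambda>j. (real j - 2) / 4 gchoose d) N / fact N)
      * sin_sinh_quotient N)"
  proof -
    \<comment> \<open>The linear coefficient is \<open>pi\<close>.\<close>
    have "sine_fps e $ 1 \<noteq> 0" for e by (simp add: sine_fps_def)
    then have "sine_fps e \<noteq> 0" for e by (metis fps_zero_nth)
    then have "sin_sinh_fps \<noteq> 0" by (auto simp: sin_sinh_fps_def)
    then show "sin_sinh_fps * H = sin_sinh_fps * A \<Longrightarrow> H = A" for A by simp
  qed
  then have "Abs_fps (\<lambda>m. Q m d) $ m = (\<Sum>N\<le>d. fps_const ((-1) ^ d * fdiff (\<lambda>j. (real j - 2) / 4 gchoose d) N / fact N)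
      * sin_sinh_quotient N) $ m"
    using fps_lim_comp_gf_Q[OF H(1)] by simp
  then show ?thesis by (simp add: fps_sum_nth)
qed

section \<open>Coefficients of the quotients\<close>

lemma sin_sinh_quotient_nth:
  assumes "r < 4"
  shows "sin_sinh_quotient (4 * q + r) $ (4 * q + m) = (- 4 * pi ^ 4) ^ q * sin_sinh_quotient r $ m"
  using assms by (simp add: sin_sinh_quotient_def Let_def mult.assoc fps_X_power_mult_nth)

lemma sin_sinh_quotient_0_nth: "m > 0 \<Longrightarrow> sin_sinh_quotient 0 $ m = 0"
  by (simp add: sin_sinh_quotient_def)

lemma sin_sinh_quotient_1_nth:
  assumes "m > 0"
  shows "sin_sinh_quotient 1 $ (4 * m) = - 4 * mzv [4 * m]"
  using assms by (simp add: sin_sinh_quotient_def even_zeta_fps_def numeral_fps_const)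

text \<open>The factor \<open>X^2\<close> moves the index to \<open>4 m - 2\<close>, whose half is
  odd. The zeta value thus enters \<open>u\<close> and \<open>v\<close> with opposite signs and
  doubles in \<open>u - v\<close>, as it does in \<open>u + v\<close> at index
  \<open>4 m\<close>.\<close>

lemma sin_sinh_quotient_3_nth:
  assumes "m > 0"
  shows "sin_sinh_quotient 3 $ (4 * m) = - 8 * pi ^ 2 * mzv [4 * m - 2]"
proof -
  have "(4 * m - 2) div 2 = 2 * m - 1" "odd (2 * m - 1)" "4 * m - 2 > 0" "4 * m \<ge> 2"
    using assms by auto
  then show ?thesis
    by (simp add: sin_sinh_quotient_def Let_def mult.assoc fps_X_power_mult_nth numeral_fps_const even_zeta_fps_def)
qed

text \<open>A direct expansion of \<open>u v\<close> would give a convolution of zeta values.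
  Instead the case \<open>d = 2\<close> of \<open>Q_eq_sum_sin_sinh_quotient\<close>, linear in this
  coefficient, is solved for it.\<close>

lemma sin_sinh_quotient_2_nth:
  assumes "m > 0"
  shows "sin_sinh_quotient 2 $ (4 * m) = 32 * (Q (4 * m) 2 - 7 / 8 * mzv [4 * m])"
proof -
  let ?q = "\<lambda>j. (real j - 2) / 4 gchoose 2"
  \<comment> \<open>The values of \<open>?q\<close> at 0, 1, 2 are 3/8, 5/32 and 0. Division of 1/16
    by \<open>fact 2\<close> gives the 1/32 below, and 7/32 times 4 gives the 7/8.\<close>
  have "fdiff ?q 1 = - 7 / 32" "fdiff ?q 2 = 1 / 16"
    by (simp_all add: fdiff_def numeral_2_eq_2 gbinomial_prod_rev)
  moreover have "{..2 :: nat} = {0, 1, 2}" by auto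
  ultimately have "Q (4 * m) 2 = - 7 / 32 * sin_sinh_quotient 1 $ (4 * m) + 1 / 32 * sin_sinh_quotient 2 $ (4 * m)"
    unfolding Q_eq_sum_sin_sinh_quotient[of _ 2] using assms by (simp add: sin_sinh_quotient_0_nth)
  then show ?thesis
    using sin_sinh_quotient_1_nth[OF assms] by simp
qed

lemma power_neg_4_pi: "(- 4 * pi ^ 4) ^ q = (-1) ^ q * 2 ^ (2 * q) * pi ^ (4 * q)"
proof -
  have "(- 4 * pi ^ 4) ^ q = ((-1) * 2 ^ 2 * pi ^ 4) ^ q" by simp
  then show ?thesis by (simp only: power_mult_distrib power_mult)
qed

text \<open>The residues 1 and 3 modulo 4 correspond to even and odd \<open>k\<close>. In both,
  \<open>(- 4 * pi ^ 4) ^ (k div 2)\<close> supplies the sign, and the factors 4 and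
  \<open>8 * pi ^ 2\<close> respectively complete \<open>2 ^ (k + 2)\<close> and
  \<open>pi ^ (2 * k)\<close>.\<close>

lemma sin_sinh_quotient_odd_nth:
  assumes "k < 2 * n"
  shows "sin_sinh_quotient (2 * k + 1) $ (4 * n)
    = - (2 ^ (k + 2) * (-1) ^ (k div 2) * mzv [4 * n - 2 * k] * pi ^ (2 * k))"
proof -
  define q where "q = k div 2"
  have qn: "q < n" using assms by (simp add: q_def)
  then have n: "4 * n = 4 * q + 4 * (n - q)" by simp
  have c: "(- 4 * pi ^ 4) ^ q = (-1) ^ q * 2 ^ (2 * q) * pi ^ (4 * q)"
    by (rule power_neg_4_pi)
  show ?thesis
  proof (cases "even k")
    case True
    then have k: "k = 2 * q" by (simp add: q_def)
    have "sin_sinh_quotient (2 * k + 1) $ (4 * n) = (- 4 * pi ^ 4) ^ q * (- 4 * mzv [4 * (n - q)])"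
      using sin_sinh_quotient_nth[of 1 q "4 * (n - q)"] sin_sinh_quotient_1_nth[of "n - q"] qn
      by (simp add: k flip: n)
    moreover have "4 * n - 2 * k = 4 * (n - q)" using k by simp
    ultimately show ?thesis unfolding c by (simp add: k power_add)
  next
    case False
    then have k: "k = 2 * q + 1" by (simp add: q_def)
    then have k3: "2 * k + 1 = 4 * q + 3" by simp
    have "sin_sinh_quotient (2 * k + 1) $ (4 * n)
        = (- 4 * pi ^ 4) ^ q * (- 8 * pi ^ 2 * mzv [4 * (n - q) - 2])"
      using sin_sinh_quotient_nth[of 3 q "4 * (n - q)"] sin_sinh_quotient_3_nth[of "n - q"] qn
      unfolding k3 by (simp flip: n)
    moreover have "4 * n - 2 * k = 4 * (n - q) - 2" using k by simp
    ultimately show ?thesis unfolding c by (simp add: k power_add power2_eq_square)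
  qed
qed

section \<open>Sorting by residues modulo 4 and the final formula\<close>

lemma sum_odd_and_2_mod_4:
  fixes g :: "nat \<Rightarrow> 'a :: comm_monoid_add"
  assumes "d \<ge> 2" and "\<And>N. N \<le> d \<Longrightarrow> 4 dvd N \<Longrightarrow> g N = 0"
  shows "(\<Sum>N\<le>d. g N) = (\<Sum>k=0..(d - 1) div 2. g (2 * k + 1)) + (\<Sum>k=0..(d - 2) div 4. g (4 * k + 2))"
proof -
  let ?A = "(\<lambda>k. 2 * k + 1) ` {0..(d - 1) div 2}" and ?B = "(\<lambda>k. 4 * k + 2) ` {0..(d - 2) div 4}"
  have "4 dvd N" if N: "N \<le> d" "N \<notin> ?A" "N \<notin> ?B" for N
  proof (rule ccontr)
    assume "\<not> 4 dvd N"
    then have "(\<exists>k. N = 2 * k + 1) \<or> (\<exists>k. N = 4 * k + 2)"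
      by presburger
    then consider k where "N = 2 * k + 1" | k where "N = 4 * k + 2"
      by blast
    then show False
      using N assms(1) by cases auto
  qed
  then have "(\<Sum>N\<le>d. g N) = sum g (?A \<union> ?B)"
    using assms by (intro sum.mono_neutral_right) auto
  also have "\<dots> = sum g ?A + sum g ?B"
    by (rule sum.union_disjoint) (auto, presburger)
  also have "\<dots> = (\<Sum>k=0..(d - 1) div 2. g (2 * k + 1)) + (\<Sum>k=0..(d - 2) div 4. g (4 * k + 2))"
    by (subst (1 2) sum.reindex) (auto simp: inj_on_def)
  finally show ?thesis .
qed

theorem theorem1p1:
  fixes n d :: nat
  assumes "3 \<le> d" and "d \<le> n"
  shows "Q (4 * n) d =
      (\<Sum>k = 0..(d - 1) div 2. \<Sum>j = 0..2 * k + 1.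
         2 ^ (k + 2) * (-1) ^ (k div 2 + j + d) / fact (2 * k + 1)
         * real ((2 * k + 1) choose j) * (((real j - 2) / 4) gchoose d)
         * mzv [4 * n - 2 * k] * pi ^ (2 * k))
    + (\<Sum>k = 0..(d - 2) div 4. \<Sum>j = 0..4 * k + 2.
         2 ^ (2 * k + 5) * (-1) ^ (k + j + d) / fact (4 * k + 2)
         * real ((4 * k + 2) choose j) * (((real j - 2) / 4) gchoose d)
         * (Q (4 * n - 4 * k) 2 - 7 / 8 * mzv [4 * n - 4 * k]) * pi ^ (4 * k))"
proof -
  let ?q = "\<lambda>j. (real j - 2) / 4 gchoose d"
  define g where "g = (\<lambda>N. (-1) ^ d * fdiff ?q N / fact N * sin_sinh_quotient N $ (4 * n))"
  \<comment> \<open>For \<open>N\<close> divisible by 4 the quotient is a constant times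
    \<open>X^N\<close>, and \<open>N <= d <= n < 4 * n\<close>.\<close>
  have "g N = 0" if "N \<le> d" "4 dvd N" for N
  proof -
    obtain q where q: "N = 4 * q" using \<open>4 dvd N\<close> unfolding dvd_def by blast
    then have "4 * n = 4 * q + 4 * (n - q)" "n - q > 0" using that assms by auto
    then have "sin_sinh_quotient N $ (4 * n) = 0"
      using sin_sinh_quotient_nth[of 0 q "4 * (n - q)"] by (simp add: q sin_sinh_quotient_0_nth)
    then show ?thesis by (simp add: g_def)
  qed
  then have "Q (4 * n) d = (\<Sum>k=0..(d - 1) div 2. g (2 * k + 1)) + (\<Sum>k=0..(d - 2) div 4. g (4 * k + 2))"
    unfolding Q_eq_sum_sin_sinh_quotient[of _ d] g_def[symmetric]
    using assms by (intro sum_odd_and_2_mod_4) auto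
  \<comment> \<open>The sign \<open>(-1)^(N + j)\<close> of the difference with \<open>N\<close> odd
    cancels the minus sign of \<open>sin_sinh_quotient_odd_nth\<close>.\<close>
  moreover have "g (2 * k + 1) = (\<Sum>j = 0..2 * k + 1.
         2 ^ (k + 2) * (-1) ^ (k div 2 + j + d) / fact (2 * k + 1)
         * real ((2 * k + 1) choose j) * ?q j * mzv [4 * n - 2 * k] * pi ^ (2 * k))"
    if "k \<in> {0..(d - 1) div 2}" for k
  proof -
    have "k < 2 * n" using that assms by auto
    then show ?thesis
      unfolding g_def fdiff_def sin_sinh_quotient_odd_nth[OF \<open>k < 2 * n\<close>] atLeast0AtMost
        sum_distrib_left sum_divide_distrib sum_distrib_right
      by (intro sum.cong refl) (simp add: power_add mult_ac del: fact_Suc binomial_Suc_Suc)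
  qed
  moreover have "g (4 * k + 2) = (\<Sum>j = 0..4 * k + 2.
         2 ^ (2 * k + 5) * (-1) ^ (k + j + d) / fact (4 * k + 2)
         * real ((4 * k + 2) choose j) * ?q j
         * (Q (4 * n - 4 * k) 2 - 7 / 8 * mzv [4 * n - 4 * k]) * pi ^ (4 * k))"
    if "k \<in> {0..(d - 2) div 4}" for k
  proof -
    define A where "A = Q (4 * n - 4 * k) 2 - 7 / 8 * mzv [4 * n - 4 * k]"
    have k: "n - k > 0" "4 * n = 4 * k + 4 * (n - k)" "4 * n - 4 * k = 4 * (n - k)" using that assms by auto
    have "sin_sinh_quotient (4 * k + 2) $ (4 * n) = (- 4 * pi ^ 4) ^ k * (32 * A)"
      using sin_sinh_quotient_nth[of 2 k "4 * (n - k)"] sin_sinh_quotient_2_nth[OF k(1)]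
      by (simp add: A_def k(3) flip: k(2))
    also have "\<dots> = 2 ^ (2 * k + 5) * (-1) ^ k * A * pi ^ (4 * k)"
      unfolding power_neg_4_pi by (simp add: power_add)
    finally show ?thesis
      unfolding A_def[symmetric] g_def fdiff_def atLeast0AtMost
        sum_distrib_left sum_divide_distrib sum_distrib_right
      by (intro sum.cong refl) (simp add: power_add mult_ac del: fact_Suc binomial_Suc_Suc)
  qed
  ultimately show ?thesis by simp
qed

end
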